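(* Let $n>2$ be an even integer and let $k=\frac n2+1$. Then $(S_{n,k})^{n/2}$ can be continued to a meromorphic function on a neighborhood of $P_{n,k}$, whereas $S_{n,k}$ cannot. That is: there are an open neighborhood $U$ of $P_{n,k}$ and a meromorphic function on $U$ that agrees with $(S_{n,k})^{n/2}$ on $U\cap\Omega_{n,k}$; but there are no open neighborhood $U$ of $P_{n,k}$ and meromorphic function on $U$ that agrees with $S_{n,k}$ on $U\cap\Omega_{n,k}$.
   Context: Let $n,k$ be integers with $n>2$, $1<k<n$. For $y\in[0,1]$ let $F_{n,k}(y)=\int_0^y(1-x^n)^{-k/n}\,dx$, let $\varphi_{n,k}=F_{n,k}(1)$ (finite), and let $S_{n,k}:[0,\varphi_{n,k}]\to[0,1]$ be the inverse function of $F_{n,k}$. Let $\omega_n=e^{2\pi i/n}$, $O=0$, $A_{n,k}=\varphi_{n,k}$, $B_{n,k}=\varphi_{n,k}\omega_n$. Let $P_{n,k}=\varphi_{n,k}e^{i\pi/n}\left(\cos\frac{\pi}{n}+\sin\frac{\pi}{n}\cot\frac{(k-1)\pi}{n}\right)$, which is the point on the ray $\{te^{i\pi/n}:t>0\}$ such that the segment from $A_{n,k}$ to $P_{n,k}$ has angle of inclination $k\pi/n$. Let $\Pi_{n,k}$ be the compact set enclosed by the polygon $OA_{n,k}P_{n,k}B_{n,k}$ (when $k=\frac n2+1$, $P_{n,k}$ is a degenerate vertex, namely the midpoint of the segment $A_{n,k}B_{n,k}$). $\Omega_{n,k}$ is the interior of $\bigcup_{j=0}^{n-1}\omega_n^j\cdot\Pi_{n,k}$.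 The real function $S_{n,k}$ has a unique analytic continuation from $[0,\varphi_{n,k})$ to the domain $\Omega_{n,k}$ (a conformal equivalence of $\Omega_{n,k}$ onto $\mathbb{C}\setminus\bigcup_{j=0}^{n-1}\omega_n^j\cdot[1,\infty)$), again denoted $S_{n,k}$. $(S_{n,k})^{n/2}$ denotes the pointwise $(n/2)$-th power. *)

theory Defs
  imports "HOL-Complex_Analysis.Complex_Analysis"
begin

(* The integrand takes the value 0 at x = 1 (as 0 powr a = 0); this does not affect the integral. *)
definition F :: "nat \<Rightarrow> nat \<Rightarrow> real \<Rightarrow> real" where
  "F n k y = integral {0..y} (\<lambda>x. (1 - x ^ n) powr (- (real k / real n)))"

definition phi :: "nat \<Rightarrow> nat \<Rightarrow> real" where
  "phi n k = F n k 1"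

(* Only meaningful on the interval from 0 to phi n k. *)
definition S_real :: "nat \<Rightarrow> nat \<Rightarrow> real \<Rightarrow> real" where
  "S_real n k = the_inv_into {0..1} (F n k)"

definition omega :: "nat \<Rightarrow> complex" where
  "omega n = cis (2 * pi / real n)"

definition A :: "nat \<Rightarrow> nat \<Rightarrow> complex" where
  "A n k = of_real (phi n k)"

definition B :: "nat \<Rightarrow> nat \<Rightarrow> complex" where
  "B n k = of_real (phi n k) * omega n"

definition P :: "nat \<Rightarrow> nat \<Rightarrow> complex" where
  "P n k = of_real (phi n k) * cis (pi / real n) *
     of_real (cos (pi / real n) + sin (pi / real n) * cot ((real k - 1) * pi / real n))"

definition polygon_OAPB :: "nat \<Rightarrow> nat \<Rightarrow> complex set" where
  "polygon_OAPB n k =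
     closed_segment 0 (A n k) \<union> closed_segment (A n k) (P n k) \<union>
     closed_segment (P n k) (B n k) \<union> closed_segment (B n k) 0"

(* inside X is the union of the bounded components of the complement of X. *)
definition Pi_region :: "nat \<Rightarrow> nat \<Rightarrow> complex set" where
  "Pi_region n k = polygon_OAPB n k \<union> inside (polygon_OAPB n k)"

definition Omega :: "nat \<Rightarrow> nat \<Rightarrow> complex set" where
  "Omega n k = interior (\<Union>j<n. (\<lambda>z. omega n ^ j * z) ` Pi_region n k)"

(* S is the analytic continuation of S_real n k to Omega n k; this determines S on
   Omega n k only, so any statement about S must not depend on its values elsewhere. *)
definition analytic_continuation_of_S :: "nat \<Rightarrow> nat \<Rightarrow> (complex \<Rightarrow> complex) \<Rightarrow> bool" where
  "analytic_continuation_of_S n k S \<longleftrightarrow>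
     S holomorphic_on Omega n k \<and>
     (\<forall>t\<in>{0..<phi n k}. S (of_real t) = of_real (S_real n k t))"

definition continues_meromorphically_to ::
    "(complex \<Rightarrow> complex) \<Rightarrow> complex set \<Rightarrow> complex \<Rightarrow> bool" where
  "continues_meromorphically_to f D p \<longleftrightarrow>
     (\<exists>U g. open U \<and> p \<in> U \<and> g meromorphic_on U \<and> (\<forall>z\<in>U \<inter> D. g z = f z))"

end

theory Submission
  imports Defs
begin

text \<open>
  Write n = 2m, k = m + 1, e = cis (pi/n), and let G be the complex primitive of
  (1 - w^n)^(-k/n) on the plane slit along the n rays from the n-th roots of unity to infinity,
  so that S (G w) = w. Since P is the midpoint of the segment AB, Omega is the interior of a
  regular n-gon, in particular convex. On the ray r e the substitution v = r (1 + r^n)^(-1/n)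
  turns G into e times the real integral of (1 - v^n)^(-1/2); a Beta function computation and
  the reflection formula show that it tends to P as r tends to infinity. In the coordinate
  y = r^(-m) the differential (1 + r^n)^(-k/n) dr becomes -(1/m) (1 + y^2)^(-k/n) dy, which
  is regular at y = 0. So y continues to a function Y holomorphic near P with a simple zero
  there, and as e^m = i, S^m Y = i first on the ray and then, by convexity and the identity theorem, on Omega near P.
  So S^m extends with a simple pole at P; if S itself extended, its order d at P
  would satisfy m d = -1, which is impossible as m \<ge> 2.
\<close>

section \<open>The real integral\<close>


text \<open>The substitution \<open>t = x ^ n\<close> in the Beta integral. It is carried out on the
  open interval, away from the possible endpoint singularities; the integrand is nonnegative, so
  integrability is absolute, as the change of variables requires.\<close>

lemma F_integrand_has_integral:
  fixes n k :: nat
  assumes "0 < n" "k < n"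
  shows "((\<lambda>x::real. (1 - x ^ n) powr - (real k / real n)) has_integral
           Beta (1 / real n) (1 - real k / real n) / real n) {0..1}"
proof -
  define f :: "real \<Rightarrow> real"
    where "f = (\<lambda>t. t powr (1 / real n - 1) * (1 - t) powr ((1 - real k / real n) - 1))"
  define b where "b = Beta (1 / real n) (1 - real k / real n)"
  have "(f has_integral b) {0<..<1}"
    using has_integral_Beta_real[of "1 / real n" "1 - real k / real n"] assms
    unfolding f_def b_def by (simp add: has_integral_Icc_iff_Ioo)
  moreover have "f absolutely_integrable_on {0<..<1}"
    using calculation by (intro nonnegative_absolutely_integrable_1) (auto simp: f_def)
  moreover have img: "(\<lambda>x::real. x ^ n) ` {0<..<1} = {0<..<1}"
  proof (intro equalityI subsetI)
    fix y :: real assume y: "y \<in> {0<..<1}"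
    then have "root n y \<in> {0<..<1}" "y = root n y ^ n"
      using assms by (auto simp: real_root_gt_zero)
    then show "y \<in> (\<lambda>x. x ^ n) ` {0<..<1}" by blast
  qed (use assms in \<open>auto simp: power_Suc_less_one power_less_one_iff\<close>)
  ultimately have "f absolutely_integrable_on ((\<lambda>x. x ^ n) ` {0<..<1}) \<and>
      integral ((\<lambda>x. x ^ n) ` {0<..<1}) f = b"
    by (simp add: integral_unique)
  then have "(\<lambda>x. \<bar>real n * x ^ (n - 1)\<bar> * f (x ^ n)) absolutely_integrable_on {0<..<1} \<and>
      integral {0<..<1} (\<lambda>x. \<bar>real n * x ^ (n - 1)\<bar> * f (x ^ n)) = b"
    by (subst has_absolute_integral_change_of_variables_1')
       (use assms in \<open>auto intro!: derivative_eq_intros inj_onI dest: power_eq_imp_eq_base\<close>)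
  then have "((\<lambda>x. \<bar>real n * x ^ (n - 1)\<bar> * f (x ^ n)) has_integral b) {0<..<1}"
    by (auto simp: has_integral_integral absolutely_integrable_on_def)
  then have *: "((\<lambda>x. (\<bar>real n * x ^ (n - 1)\<bar> * f (x ^ n)) / real n) has_integral b / real n) {0<..<1}"
    by (rule has_integral_divide)
  have eq: "(\<bar>real n * x ^ (n - 1)\<bar> * f (x ^ n)) / real n = (1 - x ^ n) powr - (real k / real n)"
    if "x \<in> {0<..<1}" for x
  proof -
    have x: "0 < x" using that by simp
    then have "(x ^ n) powr (1 / real n - 1) = x powr (1 - real n)"
      using assms by (simp add: powr_powr algebra_simps flip: powr_realpow)
    moreover have "x ^ (n - 1) = x powr (real n - 1)"
      using x assms by (simp add: powr_realpow of_nat_diff flip: powr_realpow)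
    ultimately have "x ^ (n - 1) * (x ^ n) powr (1 / real n - 1) = 1"
      using x by (simp flip: powr_add)
    then show ?thesis
      using x assms unfolding f_def by (simp add: abs_mult flip: mult.assoc)
  qed
  have "((\<lambda>x. (1 - x ^ n) powr - (real k / real n)) has_integral b / real n) {0<..<1}"
    by (rule has_integral_eq[OF eq *])
  then show ?thesis by (simp add: b_def has_integral_Icc_iff_Ioo)
qed

lemma phi_eq_Beta:
  assumes "0 < n" "k < n"
  shows "phi n k = Beta (1 / real n) (1 - real k / real n) / real n"
  unfolding phi_def F_def by (rule integral_unique) (rule F_integrand_has_integral[OF assms])

text \<open>Identifies the limit of \<open>G\<close> along the ray with the distance from O to P.
  Both sides are Beta values with \<open>a = 1 / n\<close>, and their quotient comes from the
  reflection formula for \<open>Gamma (1/2 + a) * Gamma (1/2 - a)\<close>.\<close>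

lemma phi_half:
  assumes "2 \<le> m"
  shows "phi (2 * m) m = cos (pi / real (2 * m)) * phi (2 * m) (m + 1)"
proof -
  define a where "a = 1 / real (2 * m)"
  have a: "0 < a" "a \<le> 1/4" using assms by (auto simp: a_def field_simps)
  have 1: "phi (2 * m) m = Beta a (1/2) / real (2 * m)"
    using assms by (subst phi_eq_Beta) (auto simp: a_def field_simps)
  have e: "1 - real (m + 1) / real (2 * m) = 1/2 - a"
    using assms by (simp add: a_def field_simps)
  have 2: "phi (2 * m) (m + 1) = Beta a (1/2 - a) / real (2 * m)"
    using assms e by (subst phi_eq_Beta) (auto simp: a_def)
  have r: "Gamma (1/2 + a) * Gamma (1/2 - a) = pi / cos (pi * a)"
  proof -
    have "Gamma (complex_of_real (1/2 + a)) * Gamma (1 - complex_of_real (1/2 + a)) =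
        of_real pi / sin (of_real pi * complex_of_real (1/2 + a))"
      by (rule Gamma_reflection_complex)
    also have "1 - complex_of_real (1/2 + a) = complex_of_real (1/2 - a)" by simp
    also have "of_real pi * complex_of_real (1/2 + a) = complex_of_real (pi * (1/2 + a))" by simp
    finally have "complex_of_real (Gamma (1/2 + a) * Gamma (1/2 - a)) =
        complex_of_real (pi / sin (pi * (1/2 + a)))"
      unfolding Gamma_complex_of_real sin_of_real by simp
    then have "Gamma (1/2 + a) * Gamma (1/2 - a) = pi / sin (pi * (1/2 + a))"
      using of_real_eq_iff by blast
    also have "sin (pi * (1/2 + a)) = cos (pi * a)"
      by (simp add: algebra_simps sin_add)
    finally show ?thesis .
  qed
  have c: "cos (pi * a) > 0" 
  proof (rule cos_gt_zero)
    have "pi * a < pi * (1/2)" using a by (intro mult_strict_left_mono) auto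
    then show "pi * a < pi / 2" by simp
  qed (use a in simp)
  have p: "Gamma (1/2 - a) > 0" "Gamma (1/2 + a) > 0" "Gamma a > 0" using a by auto
  have "Beta a (1/2) = Gamma a * sqrt pi / Gamma (1/2 + a)"
    by (simp add: Beta_def Gamma_one_half_real add.commute)
  also have "\<dots> = cos (pi * a) * (Gamma a * Gamma (1/2 - a) / sqrt pi)"
    using r c p by (simp add: field_simps flip: power2_eq_square)
  also have "\<dots> = cos (pi * a) * Beta a (1/2 - a)"
    by (simp add: Beta_def Gamma_one_half_real)
  finally show ?thesis using 1 2 by (simp add: a_def)
qed

section \<open>The real function \<open>F\<close> and its inverse\<close>

lemma F_0 [simp]: "F n k 0 = 0" by (simp add: F_def)

lemma continuous_on_F:
  assumes "0 < n" "k < n"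
  shows "continuous_on {0..1} (F n k)"
  unfolding F_def
  using F_integrand_has_integral[OF assms] by (intro indefinite_integral_continuous_1) blast

lemma F_integrand_continuous:
  assumes "0 < n" "b < 1"
  shows "continuous_on {0..b::real} (\<lambda>x. (1 - x ^ n) powr - (real k / real n))"
proof -
  have "x ^ n \<noteq> 1" if "x \<in> {0..b}" for x
    using that assms power_less_one_iff[of x n] by fastforce
  then show ?thesis by (intro continuous_intros) auto
qed

lemma F_has_derivative:
  assumes "0 < n" "0 < x" "x < 1"
  shows "(F n k has_real_derivative (1 - x ^ n) powr - (real k / real n)) (at x)"
proof -
  \<comment> \<open>Stopping at \<open>b\<close>, halfway between \<open>x\<close> and 1, keeps the
    integrand continuous up to the right end.\<close>
  define b where "b = (x + 1) / 2"
  have b: "x < b" "b < 1" using assms by (auto simp: b_def)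
  have "((\<lambda>x. F n k x) has_real_derivative (1 - x ^ n) powr - (real k / real n)) (at x within {0..b})"
    unfolding F_def
    by (rule integral_has_real_derivative)
       (use assms b in \<open>auto intro!: F_integrand_continuous\<close>)
  then show ?thesis
    using assms b by (simp add: at_within_Icc_at)
qed

text \<open>The derivative is positive inside the interval, and continuity of \<open>F\<close> up to
  1 admits the singular endpoint \<open>y = 1\<close>.\<close>

lemma F_strict_mono:
  assumes "0 < n" "k < n" "0 \<le> x" "x < y" "y \<le> 1"
  shows "F n k x < F n k y"
proof (rule DERIV_pos_imp_increasing_open[where f = "F n k"])
  fix t assume t: "x < t" "t < y"
  then have "0 < (1 - t ^ n) powr - (real k / real n)"
    using assms power_less_one_iff[of t n] by auto
  then show "\<exists>d. DERIV (F n k) t :> d \<and> 0 < d"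
    using F_has_derivative[of n t k] t assms by force
next
  show "continuous_on {x..y} (F n k)"
    by (rule continuous_on_subset[OF continuous_on_F]) (use assms in auto)
qed (fact assms)

lemma phi_pos: "0 < n \<Longrightarrow> k < n \<Longrightarrow> 0 < phi n k"
  using F_strict_mono[of n k 0 1] by (simp add: phi_def)

lemma F_in_range:
  assumes "0 < n" "k < n" "0 \<le> t" "t < 1"
  shows "F n k t \<in> {0..<phi n k}"
  using F_strict_mono[of n k 0 t] F_strict_mono[of n k t 1] assms
  by (cases "t = 0") (auto simp: phi_def)

lemma S_real_F:
  assumes "0 < n" "k < n" "0 \<le> t" "t < 1"
  shows "S_real n k (F n k t) = t"
proof -
  have "inj_on (F n k) {0..1}"
  proof (rule inj_onI, rule ccontr)
    fix x y assume "x \<in> {0..1}" "y \<in> {0..1}" "F n k x = F n k y" "x \<noteq> y"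
    then show False
      using F_strict_mono[of n k x y] F_strict_mono[of n k y x] assms
      by (cases "x < y") auto
  qed
  then show ?thesis
    unfolding S_real_def using assms by (intro the_inv_into_f_f) auto
qed

section \<open>The domain\<close>


text \<open>An odd \<open>l\<close> in this range is at distance at least 1 from 0 and from
  \<open>2 * n\<close> in absolute value, so the angle is at least \<open>pi / n\<close> away from
  every multiple of \<open>2 * pi\<close>. It serves for the angles between edge normals and
  vertices of the n-gon.\<close>

lemma cos_odd_mult_le:
  fixes l :: int
  assumes "odd l" "\<bar>l\<bar> < 2 * int n"
  shows "cos (of_int l * (pi / real n)) \<le> cos (pi / real n)"
proof -
  have n: "n > 0" using assms by (cases n) auto
  have main: "cos (of_int i * (pi / real n)) \<le> cos (pi / real n)" if i: "1 \<le> i" "i \<le> int n" for i :: int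
  proof (rule cos_monotone_0_pi_le)
    show "pi / real n \<le> of_int i * (pi / real n)"
      using i n by (simp add: field_simps)
    have "of_int i \<le> real n" using i by linarith
    then show "of_int i * (pi / real n) \<le> pi"
      using n by (simp add: field_simps)
  qed simp
  have l: "1 \<le> \<bar>l\<bar>" using assms by (cases "l = 0") auto
  have abs: "cos (of_int l * (pi / real n)) = cos (of_int \<bar>l\<bar> * (pi / real n))"
    by (cases "l \<ge> 0") auto
  show ?thesis
  proof (cases "\<bar>l\<bar> \<le> int n")
    case True
    then show ?thesis using main[of "\<bar>l\<bar>"] l abs by simp
  next
    case False
    have "of_int (2 * int n - \<bar>l\<bar>) * (pi / real n) = 2 * pi - of_int \<bar>l\<bar> * (pi / real n)"
      using n by (simp add: field_simps)
    then have "cos (of_int (2 * int n - \<bar>l\<bar>) * (pi / real n)) = cos (of_int \<bar>l\<bar> * (pi / real n))"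
      by (simp add: cos_diff)
    then show ?thesis using main[of "2 * int n - \<bar>l\<bar>"] False assms abs by simp
  qed
qed

lemma inner_cis_cis: "cis a \<bullet> cis b = cos (a - b)"
  by (simp add: inner_complex_def cos_diff)

lemma omega_power: "omega n ^ j = cis (2 * real j * (pi / real n))"
  by (simp add: omega_def Complex.DeMoivre mult_ac)

text \<open>The coefficients solve the linear system by the sine rule:
  \<open>sin (d - s) / sin d\<close> and \<open>sin s / sin d\<close>.\<close>

lemma sector_decomposition:
  assumes "0 \<le> s" "s \<le> d" "0 < d" "d < pi"
  obtains a b where "0 \<le> a" "0 \<le> b" "cis s = of_real a + of_real b * cis d"
proof
  have sd: "sin d > 0" using assms by (intro sin_gt_zero) auto
  show "0 \<le> sin (d - s) / sin d" "0 \<le> sin s / sin d"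
    using assms sd by (auto intro!: divide_nonneg_pos sin_ge_zero)
  show "cis s = of_real (sin (d - s) / sin d) + of_real (sin s / sin d) * cis d"
    using sd by (auto simp: complex_eq_iff sin_diff field_simps)
qed

text \<open>Two descriptions of the regular n-gon with circumradius \<open>p\<close>: by central
  triangles, and by half planes whose normals point to the edge midpoints at distance
  \<open>p * cos (pi / n)\<close>. The second makes convexity evident and membership a matter of
  inner products.\<close>

lemma regular_polygon_eq_halfplanes:
  fixes p :: real and n :: nat
  assumes n: "2 < n" and p: "0 \<le> p"
  defines "T \<equiv> convex hull {0, of_real p, of_real p * omega n}"
  shows "(\<Union>j<n. (\<lambda>z. omega n ^ j * z) ` T) =
         (\<Inter>j<n. {z. cis ((2 * real j + 1) * (pi / real n)) \<bullet> z \<le> p * cos (pi / real n)})"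
    (is "?L = ?R")
proof -
  define d where "d = pi / real n"
  have d: "0 < d" "2 * d < pi" using n by (auto simp: d_def field_simps)
  have cd: "cos d > 0" using d by (intro cos_gt_zero) auto
  have om: "omega n = cis (2 * d)" by (simp add: omega_def d_def)
  have pw: "omega n ^ j = cis (2 * real j * d)" for j by (simp add: omega_power d_def)
  have T: "T = {of_real (p * u) + of_real (p * v) * cis (2 * d) | u v. 0 \<le> u \<and> 0 \<le> v \<and> u + v \<le> 1}"
    by (simp add: T_def convex_hull_3_alt om scaleR_conv_of_real mult_ac)
  have inner_eq: "cis x \<bullet> (cis y * (of_real a + of_real b * cis z)) = a * cos (x - y) + b * cos (x - y - z)" for a b x y z
  proof -
    have "cis y * (of_real a + of_real b * cis z) = a *\<^sub>R cis y + b *\<^sub>R cis (y + z)"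
      by (simp add: scaleR_conv_of_real algebra_simps cis_mult)
    then show ?thesis by (simp only: inner_add_right inner_scaleR_right inner_cis_cis) (simp add: algebra_simps)
  qed
  show ?thesis
  proof (intro equalityI subsetI)
    fix w assume "w \<in> ?L"
    then obtain j u v where j: "j < n" and uv: "0 \<le> u" "0 \<le> v" "u + v \<le> 1"
      and w: "w = cis (2 * real j * d) * (of_real (p * u) + of_real (p * v) * cis (2 * d))"
      unfolding T pw by auto
    show "w \<in> ?R"
    proof (intro INT_I CollectI)
      fix i assume i: "i \<in> {..<n}"
      \<comment> \<open>Angles between the normal of edge \<open>i\<close> and the two outer
        vertices of triangle \<open>j\<close>; both are odd multiples of \<open>d\<close>.\<close>
      have c1: "cos ((2 * real i + 1) * d - 2 * real j * d) \<le> cos d"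
        using cos_odd_mult_le[of "2 * int i + 1 - 2 * int j" n] i j
        by (simp add: d_def algebra_simps)
      have c2: "cos ((2 * real i + 1) * d - 2 * real j * d - 2 * d) \<le> cos d"
        using cos_odd_mult_le[of "2 * int i + 1 - 2 * int j - 2" n] i j
        by (simp add: d_def algebra_simps)
      have "cis ((2 * real i + 1) * d) \<bullet> w \<le> p * u * cos d + p * v * cos d"
        unfolding w inner_eq using uv p by (intro add_mono mult_left_mono c1 c2) auto
      also have "\<dots> = (u + v) * (p * cos d)" by (simp add: algebra_simps)
      also have "\<dots> \<le> 1 * (p * cos d)" using uv p cd by (intro mult_right_mono) auto
      finally show "cis ((2 * real i + 1) * (pi / real n)) \<bullet> w \<le> p * cos (pi / real n)"
        by (simp add: d_def)
    qed
  next
    fix w assume w: "w \<in> ?R"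
    define r where "r = cmod w"
    define \<theta> where "\<theta> = Arg2pi w"
    have wr: "w = of_real r * cis \<theta>"
      using Arg2pi_eq[of w] by (simp add: r_def \<theta>_def cis_conv_exp)
    have th: "0 \<le> \<theta>" "\<theta> < 2 * pi" by (auto simp: \<theta>_def Arg2pi_ge_0 Arg2pi_lt_2pi)
    \<comment> \<open>The index of the sector of opening \<open>2 * d\<close> that contains
      \<open>w\<close>; \<open>s\<close> will be the angle of \<open>w\<close> inside it.\<close>
    define j where "j = nat \<lfloor>\<theta> / (2 * d)\<rfloor>"
    have j1: "real j \<le> \<theta> / (2 * d)" "\<theta> / (2 * d) < real j + 1"
      using th d unfolding j_def by (auto simp: of_nat_nat)
    have "\<theta> / (2 * d) < real n" using th d n by (simp add: d_def field_simps)
    then have jn: "j < n" using j1 by linarith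
    define s where "s = \<theta> - 2 * real j * d"
    have s: "0 \<le> s" "s \<le> 2 * d" using j1 d by (auto simp: s_def field_simps)
    obtain a b where ab: "0 \<le> a" "0 \<le> b" and cs: "cis s = of_real a + of_real b * cis (2 * d)"
      using sector_decomposition[of s "2 * d"] s d by auto
    have w2: "w = cis (2 * real j * d) * (of_real (r * a) + of_real (r * b) * cis (2 * d))"
    proof -
      have "w = of_real r * (cis (2 * real j * d) * cis s)" by (simp add: wr s_def cis_mult)
      then show ?thesis by (simp add: cs algebra_simps)
    qed
    \<comment> \<open>The half plane of this one sector suffices: both sides of the sector make the
      angle \<open>d\<close> with its normal, so the inequality bounds the sum of the two
      coefficients.\<close>
    have "cis ((2 * real j + 1) * d) \<bullet> w \<le> p * cos d" using w jn by (auto simp: d_def)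
    then have le: "(r * a + r * b) * cos d \<le> p * cos d"
      unfolding w2 inner_eq by (simp add: algebra_simps)
    then have le: "r * a + r * b \<le> p" using cd by simp
    have r0: "0 \<le> r * a" "0 \<le> r * b" using ab by (auto simp: r_def)
    obtain u v where uv: "0 \<le> u" "0 \<le> v" "u + v \<le> 1" "r * a = p * u" "r * b = p * v"
    proof (cases "p = 0")
      case True
      then have "r * a = 0" "r * b = 0" using le r0 by linarith+
      then show ?thesis using that[of 0 0] by simp
    next
      case False
      then show ?thesis using that[of "r * a / p" "r * b / p"] le r0 p
        by (auto simp: field_simps)
    qed
    then have "of_real (r * a) + of_real (r * b) * cis (2 * d) \<in> T" unfolding T by auto
    then show "w \<in> ?L" using jn w2 pw by auto
  qed
qed

text \<open>Here \<open>(k - 1) * pi / n\<close> is a right angle, so the cotangent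
  vanishes.\<close>

lemma P_even:
  assumes "2 \<le> m"
  shows "P (2 * m) (m + 1) =
    of_real (phi (2 * m) (m + 1) * cos (pi / real (2 * m))) * cis (pi / real (2 * m))"
proof -
  have "(real (m + 1) - 1) * pi / real (2 * m) = pi / 2" using assms by simp
  then show ?thesis unfolding P_def by (simp add: cot_def)
qed

lemma P_even':
  assumes "2 \<le> m"
  shows "P (2 * m) (m + 1) = of_real (phi (2 * m) m) * cis (pi / real (2 * m))"
  using P_even[OF assms] phi_half[OF assms] by (simp add: mult.commute)

text \<open>P is the midpoint of AB, so the quadrilateral degenerates to the triangle OAB, whose
  frontier and inside are known.\<close>

lemma Pi_region_even:
  assumes m: "2 \<le> m"
  shows "Pi_region (2 * m) (m + 1) =
    convex hull {0, of_real (phi (2 * m) (m + 1)), of_real (phi (2 * m) (m + 1)) * omega (2 * m)}"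
proof -
  define n k where "n = 2 * m" and "k = m + 1"
  define T where "T = convex hull {0, A n k, B n k}"
  have "P n k = midpoint (A n k) (B n k)"
  proof -
    define d where "d = pi / real n"
    \<comment> \<open>The midpoint of 1 and \<open>cis (2 * d)\<close> lies in the direction
      \<open>cis d\<close> at distance \<open>cos d\<close>.\<close>
    have "of_real (cos d) * cis d = (1 + cis (2 * d)) / 2"
      by (simp add: complex_eq_iff cos_double_cos sin_double power2_eq_square)
    moreover have "cis (2 * d) = omega n" by (simp add: omega_def d_def)
    moreover have "P n k = of_real (phi n k) * (of_real (cos d) * cis d)"
      using P_even[OF m] by (simp add: n_def k_def d_def)
    ultimately have "P n k = of_real (phi n k) * ((1 + omega n) / 2)" by (simp only:)
    then show ?thesis
      by (simp add: midpoint_def A_def B_def scaleR_conv_of_real field_simps)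
  qed
  then have "P n k \<in> closed_segment (A n k) (B n k)" by simp
  then have pg: "polygon_OAPB n k =
      closed_segment 0 (A n k) \<union> closed_segment (A n k) (B n k) \<union> closed_segment (B n k) 0"
    unfolding polygon_OAPB_def using Un_closed_segment by blast
  have "polygon_OAPB n k = frontier T"
    unfolding pg T_def by (subst frontier_of_triangle) auto
  moreover have "inside (polygon_OAPB n k) = interior T"
    unfolding pg T_def by (rule inside_of_triangle) simp
  moreover have "closed T"
    unfolding T_def by (intro compact_imp_closed compact_convex_hull) (simp add: finite_imp_compact)
  ultimately have "Pi_region n k = T"
    unfolding Pi_region_def
    by (simp add: frontier_def closure_closed) (use interior_subset in blast)
  then show ?thesis by (simp add: T_def n_def k_def A_def B_def)
qed

lemma Omega_even_eq:
  assumes m: "2 \<le> m"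
  shows "Omega (2 * m) (m + 1) = interior (\<Inter>j<2 * m.
    {z. cis ((2 * real j + 1) * (pi / real (2 * m))) \<bullet> z \<le> phi (2 * m) (m + 1) * cos (pi / real (2 * m))})"
proof -
  have "0 \<le> phi (2 * m) (m + 1)" using phi_pos[of "2 * m" "m + 1"] m by simp
  then show ?thesis
    unfolding Omega_def Pi_region_even[OF m]
    using regular_polygon_eq_halfplanes[of "2 * m" "phi (2 * m) (m + 1)"] m by simp
qed

lemma open_Omega: "open (Omega n k)" by (simp add: Omega_def)

text \<open>Used to make the part of \<open>Omega\<close> inside a disc around P connected.\<close>

lemma convex_Omega_even: "2 \<le> m \<Longrightarrow> convex (Omega (2 * m) (m + 1))"
  unfolding Omega_even_eq by (intro convex_interior convex_INT convex_halfspace_le)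

lemma in_Omega_even:
  assumes m: "2 \<le> m"
    and z: "\<And>j. j < 2 * m \<Longrightarrow> cis ((2 * real j + 1) * (pi / real (2 * m))) \<bullet> z <
                phi (2 * m) (m + 1) * cos (pi / real (2 * m))"
  shows "z \<in> Omega (2 * m) (m + 1)"
proof -
  have "open (\<Inter>j<2 * m. {z. cis ((2 * real j + 1) * (pi / real (2 * m))) \<bullet> z <
                phi (2 * m) (m + 1) * cos (pi / real (2 * m))})"
    by (intro open_INT ballI open_halfspace_lt) auto
  then show ?thesis
    unfolding Omega_even_eq[OF m] using z by (intro interiorI) (auto intro: less_imp_le)
qed

lemma real_in_Omega_even:
  assumes m: "2 \<le> m" and t: "0 \<le> t" "t < phi (2 * m) (m + 1)"
  shows "of_real t \<in> Omega (2 * m) (m + 1)"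
proof (rule in_Omega_even[OF m])
  fix j assume j: "j < 2 * m"
  have c: "cos (pi / real (2 * m)) > 0" using m by (intro cos_gt_zero) (auto simp: field_simps)
  have "cis ((2 * real j + 1) * (pi / real (2 * m))) \<bullet> of_real t =
      t * cos (of_int (2 * int j + 1) * (pi / real (2 * m)))"
    by (simp add: inner_complex_def)
  also have "\<dots> \<le> t * cos (pi / real (2 * m))"
    using j t by (intro mult_left_mono cos_odd_mult_le) auto
  also have "\<dots> < phi (2 * m) (m + 1) * cos (pi / real (2 * m))"
    using c t by (intro mult_strict_right_mono) auto
  finally show "cis ((2 * real j + 1) * (pi / real (2 * m))) \<bullet> of_real t <
      phi (2 * m) (m + 1) * cos (pi / real (2 * m))" .
qed

text \<open>By \<open>phi_half\<close> the bound on \<open>t\<close> is the apothem of the polygon,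
  and no inner product with a unit normal exceeds \<open>t\<close>.\<close>

lemma ray_in_Omega_even:
  assumes m: "2 \<le> m" and t: "0 \<le> t" "t < phi (2 * m) m"
  shows "of_real t * cis (pi / real (2 * m)) \<in> Omega (2 * m) (m + 1)"
proof (rule in_Omega_even[OF m])
  fix j assume j: "j < 2 * m"
  let ?a = "(2 * real j + 1) * (pi / real (2 * m))"
  have "cis ?a \<bullet> (of_real t * cis (pi / real (2 * m))) = t * cos (?a - pi / real (2 * m))"
    by (metis inner_cis_cis inner_scaleR_right scaleR_conv_of_real)
  also have "\<dots> \<le> t" using mult_left_mono[OF cos_le_one t(1)] by simp
  finally show "cis ?a \<bullet> (of_real t * cis (pi / real (2 * m))) <
      phi (2 * m) (m + 1) * cos (pi / real (2 * m))"
    using t phi_half[OF m] by (simp add: mult.commute)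
qed

section \<open>The complex primitive\<close>


text \<open>For positive \<open>n\<close> this removes the rays from the n-th roots of unity to
  infinity. The form says that \<open>1 - w ^ n\<close> stays where the principal power is
  holomorphic.\<close>

definition slit_plane :: "nat \<Rightarrow> complex set" where
  "slit_plane n = {w. 1 - w ^ n \<notin> \<real>\<^sub>\<le>\<^sub>0}"

lemma open_slit_plane: "open (slit_plane n)"
proof -
  have "open ((\<lambda>w::complex. 1 - w ^ n) -` (- \<real>\<^sub>\<le>\<^sub>0))"
    by (intro open_vimage continuous_intros) (auto simp: closed_nonpos_Reals_complex)
  then show ?thesis by (simp add: slit_plane_def vimage_def)
qed

text \<open>If the shrunken point has its n-th power in \<open>[1, oo)\<close>, then so does
  \<open>w\<close>, whose power is the same number divided by \<open>t ^ n\<close>, which is at most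
  1. This gives starlikeness about 0 and hence a primitive.\<close>

lemma scale_in_slit_plane:
  assumes "w \<in> slit_plane n" "0 \<le> t" "t \<le> 1" "0 < n"
  shows "of_real t * w \<in> slit_plane n"
proof (rule ccontr)
  assume "of_real t * w \<notin> slit_plane n"
  then have im: "Im (of_real (t ^ n) * w ^ n) = 0" and re: "1 \<le> Re (of_real (t ^ n) * w ^ n)"
    by (auto simp: slit_plane_def complex_nonpos_Reals_iff power_mult_distrib simp del: of_real_power)
  have "t \<noteq> 0"
  proof
    assume "t = 0"
    then show False using re assms(4) by (simp add: power_0_left)
  qed
  then have tn: "0 < t ^ n" "t ^ n \<le> 1"
    using assms by (auto simp: power_le_one)
  have "Im (w ^ n) = 0" using im \<open>t \<noteq> 0\<close> by (auto simp del: of_real_power)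
  moreover have "1 \<le> Re (w ^ n)"
  proof -
    have "1 \<le> t ^ n * Re (w ^ n)" using re by (simp del: of_real_power)
    moreover have "0 < Re (w ^ n)"
      using calculation tn mult_nonneg_nonpos[of "t ^ n" "Re (w ^ n)"] by linarith
    then have "t ^ n * Re (w ^ n) \<le> 1 * Re (w ^ n)" using tn by (intro mult_right_mono) auto
    ultimately show ?thesis by simp
  qed
  ultimately have "1 - w ^ n \<in> \<real>\<^sub>\<le>\<^sub>0" by (simp add: complex_nonpos_Reals_iff)
  then show False using assms by (simp add: slit_plane_def)
qed

lemma zero_in_slit_plane: "0 < n \<Longrightarrow> 0 \<in> slit_plane n"
  by (simp add: slit_plane_def power_0_left)

lemma starlike_slit_plane:
  assumes "0 < n"
  shows "starlike (slit_plane n)"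
  unfolding starlike_def
proof (intro bexI ballI subsetI)
  fix w z assume "w \<in> slit_plane n" "z \<in> closed_segment 0 w"
  then show "z \<in> slit_plane n"
    using scale_in_slit_plane assms by (auto simp: closed_segment_def scaleR_conv_of_real)
qed (simp add: assms zero_in_slit_plane)

lemma of_real_in_slit_plane:
  assumes "0 < n" "0 \<le> t" "t < 1"
  shows "of_real t \<in> slit_plane n"
  using assms power_less_one_iff[of t n]
  by (simp add: slit_plane_def complex_nonpos_Reals_iff flip: of_real_power)

lemma cis_pi_div_power: "0 < n \<Longrightarrow> cis (pi / real n) ^ n = -1"
  by (simp add: Complex.DeMoivre)

lemma ray_in_slit_plane:
  assumes "0 < n" "0 \<le> r"
  shows "of_real r * cis (pi / real n) \<in> slit_plane n"
proof -
  have "- 1 < r ^ n" using zero_le_power[OF assms(2), of n] by linarith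
  then show ?thesis
    using assms by (simp add: slit_plane_def complex_nonpos_Reals_iff power_mult_distrib
      cis_pi_div_power flip: of_real_power)
qed

text \<open>A holomorphic function on an open starlike set has a primitive; subtracting its value at
  0 matches the normalisation of \<open>F\<close>.\<close>

lemma complex_F_exists:
  assumes "0 < n"
  obtains G where "\<And>w. w \<in> slit_plane n \<Longrightarrow>
      (G has_field_derivative (1 - w ^ n) powr - of_real (real k / real n)) (at w)" "G 0 = 0"
proof -
  let ?f = "\<lambda>w::complex. (1 - w ^ n) powr - of_real (real k / real n)"
  have hol: "?f holomorphic_on slit_plane n"
    by (intro holomorphic_intros) (auto simp: slit_plane_def)
  obtain G where G: "\<forall>w\<in>slit_plane n. (G has_field_derivative ?f w) (at w)"
    using holomorphic_starlike_primitive[OF holomorphic_on_imp_continuous_on[OF hol]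
        starlike_slit_plane[OF assms] open_slit_plane, of "{}"] hol
    by (auto simp: holomorphic_on_def at_within_open[OF _ open_slit_plane])
  show ?thesis
    by (rule that[of "\<lambda>w. G w - G 0"]) (use G in \<open>auto intro!: derivative_eq_intros\<close>)
qed

lemma of_real_powr_neg: "0 < x \<Longrightarrow> complex_of_real x powr - of_real a = of_real (x powr - a)"
  by (simp add: powr_of_real flip: of_real_minus)

locale complex_F =
  fixes n k :: nat and G :: "complex \<Rightarrow> complex"
  assumes n: "0 < n" and k: "k < n"
    and G: "w \<in> slit_plane n \<Longrightarrow>
      (G has_field_derivative (1 - w ^ n) powr - of_real (real k / real n)) (at w)"
    and G0: "G 0 = 0"
begin

lemma holomorphic_G: "G holomorphic_on slit_plane n"
  using G by (auto simp: holomorphic_on_open open_slit_plane)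

text \<open>The fundamental theorem of calculus on \<open>[0, t]\<close>, which stays off the slits
  since \<open>t < 1\<close>.\<close>

lemma G_real:
  assumes t: "0 \<le> t" "t < 1"
  shows "G (of_real t) = of_real (F n k t)"
proof -
  have d: "((\<lambda>x. G (of_real x)) has_vector_derivative
      of_real ((1 - x ^ n) powr - (real k / real n))) (at x within {0..t})" if x: "x \<in> {0..t}" for x
  proof -
    have x1: "0 \<le> x" "x < 1" using x t by auto
    have "0 < 1 - x ^ n" using x1 n power_less_one_iff[of x n] by simp
    then have "(1 - of_real x ^ n) powr - of_real (real k / real n) =
        complex_of_real ((1 - x ^ n) powr - (real k / real n))"
      by (simp flip: of_real_powr_neg)
    then have "(G has_field_derivative of_real ((1 - x ^ n) powr - (real k / real n))) (at (of_real x))"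
      using G[of "of_real x"] of_real_in_slit_plane[OF n x1] by simp
    then show ?thesis
      by (rule has_vector_derivative_at_within[OF has_vector_derivative_real_field])
  qed
  have "((\<lambda>x. complex_of_real ((1 - x ^ n) powr - (real k / real n))) has_integral
      (G (of_real t) - G (of_real 0))) {0..t}"
    by (rule fundamental_theorem_of_calculus[OF t(1) d])
  moreover have "((\<lambda>x. (1 - x ^ n) powr - (real k / real n)) has_integral F n k t) {0..t}"
  proof -
    have "(\<lambda>x. (1 - x ^ n) powr - (real k / real n)) integrable_on {0..t}"
      using t n by (intro integrable_continuous_real F_integrand_continuous)
    then show ?thesis by (simp add: F_def integrable_integral)
  qed
  then have "((\<lambda>x. complex_of_real ((1 - x ^ n) powr - (real k / real n))) has_integral
      of_real (F n k t)) {0..t}" by (rule has_integral_of_real)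
  ultimately have "G (of_real t) - G (of_real 0) = of_real (F n k t)"
    by (rule has_integral_unique)
  then show ?thesis by (simp add: G0)
qed

text \<open>The unit interval and C meet at the origin, so the identity theorem carries
  S (G w) = w from the interval to C.\<close>
lemma continuation_inverts_G:
  assumes S: "analytic_continuation_of_S n k S"
    and C: "connected C" "0 \<in> C" "C \<subseteq> slit_plane n" "G ` C \<subseteq> Omega n k"
    and real: "\<And>t. 0 \<le> t \<Longrightarrow> t < phi n k \<Longrightarrow> of_real t \<in> Omega n k"
    and w: "w \<in> C"
  shows "S (G w) = w"
proof -
  define I where "I = complex_of_real ` {0..<1}"
  \<comment> \<open>The set on which \<open>S (G w)\<close> is holomorphic. It need not be
    connected, so the identity theorem is applied on the component \<open>V\<close> of 0, which
    contains both the interval and \<open>C\<close>.\<close>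
  define W where "W = slit_plane n \<inter> G -` Omega n k"
  define V where "V = connected_component_set W 0"
  have opW: "open W"
    unfolding W_def
    using continuous_open_preimage[OF holomorphic_on_imp_continuous_on[OF holomorphic_G]]
      open_slit_plane open_Omega by blast
  have IW: "I \<subseteq> W"
    using of_real_in_slit_plane[OF n] G_real F_in_range[OF n k] real by (auto simp: I_def W_def)
  have conI: "connected I"
    unfolding I_def by (intro connected_continuous_image continuous_intros) simp
  have "0 \<in> I" by (auto simp: I_def intro!: image_eqI[of _ _ 0])
  then have IV: "I \<subseteq> V"
    unfolding V_def using IW conI by (intro connected_component_maximal) auto
  have CV: "C \<subseteq> V"
    unfolding V_def using C by (intro connected_component_maximal) (auto simp: W_def)
  have opV: "open V" and conV: "connected V" and VW: "V \<subseteq> W"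
    using opW by (auto simp: V_def open_connected_component connected_component_subset)
  have hol: "(\<lambda>w. S (G w) - w) holomorphic_on V"
  proof -
    have "S \<circ> G holomorphic_on V"
    proof (rule holomorphic_on_compose_gen)
      show "G holomorphic_on V"
        using holomorphic_G by (rule holomorphic_on_subset) (use VW W_def in auto)
      show "S holomorphic_on Omega n k"
        using S by (simp add: analytic_continuation_of_S_def)
      show "G ` V \<subseteq> Omega n k" using VW by (auto simp: W_def)
    qed
    then show ?thesis by (intro holomorphic_intros) (simp add: o_def)
  qed
  have "S (G w) - w = 0"
  proof (rule analytic_continuation[OF hol opV conV IV])
    show "0 \<in> V" using \<open>0 \<in> I\<close> IV by auto
    have "(0::complex) islimpt I"
    proof -
      have "complex_of_real (1 / 2) \<in> I" unfolding I_def by (intro imageI) simp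
      then have "I \<noteq> {x}" for x using \<open>0 \<in> I\<close> by (cases "x = 0") auto
      then show ?thesis using connected_imp_perfect[OF conI \<open>0 \<in> I\<close>] by blast
    qed
    then show "0 islimpt I" .
    show "w \<in> V" using w CV by auto
    fix z assume "z \<in> I"
    then obtain t where t: "z = of_real t" "0 \<le> t" "t < 1" by (auto simp: I_def)
    then have "S (G z) = of_real (S_real n k (F n k t))"
      using S F_in_range[OF n k t(2,3)] by (simp add: G_real analytic_continuation_of_S_def)
    then show "S (G z) - z = 0" using S_real_F[OF n k t(2,3)] t by simp
  qed
  then show ?thesis by simp
qed

end

section \<open>The ray from the origin to infinity\<close>


lemma one_plus_power_pos: "0 \<le> (r::real) \<Longrightarrow> 0 < 1 + r ^ n"
  by (simp add: add_pos_nonneg)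

text \<open>The substitution \<open>v = r * (1 + r ^ n) powr - (1 / n)\<close>, chosen so that
  \<open>1 - v ^ n = 1 / (1 + r ^ n)\<close>; it takes the half line into
  \<open>[0, 1)\<close>.\<close>

definition ray_sub :: "nat \<Rightarrow> real \<Rightarrow> real" where
  "ray_sub n r = r * (1 + r ^ n) powr - (1 / real n)"

lemma ray_sub_power:
  assumes "0 < n" "0 \<le> r"
  shows "ray_sub n r ^ n = r ^ n / (1 + r ^ n)"
proof -
  have "((1 + r ^ n) powr - (1 / real n)) ^ n = (1 + r ^ n) powr - 1"
    using assms one_plus_power_pos[of r n] by (subst powr_power) auto
  then show ?thesis
    using assms one_plus_power_pos[of r n]
    by (simp add: ray_sub_def power_mult_distrib powr_neg_one)
qed

lemma ray_sub_range:
  assumes "0 < n" "0 \<le> r"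
  shows "0 \<le> ray_sub n r" "ray_sub n r < 1"
proof -
  show nn: "0 \<le> ray_sub n r" using assms by (simp add: ray_sub_def)
  have "ray_sub n r ^ n < 1"
    using ray_sub_power[OF assms] one_plus_power_pos[of r n] assms by simp
  then show "ray_sub n r < 1" using nn assms by (simp add: power_less_one_iff)
qed

lemma ray_sub_pos: "0 < r \<Longrightarrow> 0 < ray_sub n r"
  using one_plus_power_pos[of r n] by (simp add: ray_sub_def)

lemma ray_sub_0 [simp]: "ray_sub n 0 = 0"
  by (simp add: ray_sub_def)

lemma ray_sub_has_derivative:
  assumes "0 < n" "0 < r"
  shows "(ray_sub n has_real_derivative (1 + r ^ n) powr (- (1 / real n) - 1)) (at r)"
proof -
  define a where "a = - (1 / real n)"
  define Q where "Q = 1 + r ^ n"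
  have Q: "0 < Q" using assms one_plus_power_pos[of r n] by (simp add: Q_def)
  have d: "((\<lambda>r. (1 + r ^ n) powr a) has_real_derivative
      (a * Q powr (a - 1)) * (real n * r ^ (n - 1))) (at r)"
    unfolding Q_def
    by (rule DERIV_chain2[OF has_real_derivative_powr])
       (use Q in \<open>auto simp: Q_def intro!: derivative_eq_intros\<close>)
  have "((\<lambda>r. r * (1 + r ^ n) powr a) has_real_derivative
      1 * (1 + r ^ n) powr a + (a * Q powr (a - 1)) * (real n * r ^ (n - 1)) * r) (at r)"
    by (rule DERIV_mult[OF DERIV_ident d])
  also have "1 * (1 + r ^ n) powr a + (a * Q powr (a - 1)) * (real n * r ^ (n - 1)) * r =
      Q powr a - Q powr (a - 1) * (r ^ (n - 1) * r)"
    using assms by (simp add: Q_def a_def)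
  also have "r ^ (n - 1) * r = r ^ n"
    by (rule power_minus_mult[OF assms(1)])
  also have "Q powr a = Q powr (a - 1) * Q"
    using Q by (simp add: powr_diff)
  also have "Q powr (a - 1) * Q - Q powr (a - 1) * r ^ n = Q powr (a - 1) * (Q - r ^ n)"
    by (simp add: algebra_simps)
  also have "\<dots> = Q powr (a - 1)" by (simp add: Q_def)
  finally show ?thesis by (simp add: ray_sub_def[abs_def] a_def Q_def)
qed

lemma continuous_on_ray_sub: "0 < n \<Longrightarrow> continuous_on {0..} (ray_sub n)"
  unfolding ray_sub_def[abs_def]
  by (intro continuous_intros) (metis atLeast_iff less_irrefl one_plus_power_pos)

text \<open>For \<open>r \<ge> 0\<close> the function is the n-th root of
  \<open>1 - 1 / (1 + r ^ n)\<close>.\<close>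

lemma ray_sub_tendsto: 
  assumes "0 < n"
  shows "(ray_sub n \<longlongrightarrow> 1) at_top"
proof -
  have top: "filterlim (\<lambda>r::real. 1 + r ^ n) at_top at_top"
    by (intro filterlim_tendsto_add_at_top[OF tendsto_const] filterlim_pow_at_top filterlim_ident assms)
  have "((\<lambda>r::real. 1 - inverse (1 + r ^ n)) \<longlongrightarrow> 1 - 0) at_top"
    by (intro tendsto_diff tendsto_const filterlim_compose[OF tendsto_inverse_0_at_top[OF filterlim_ident] top])
  then have "((\<lambda>r::real. root n (1 - inverse (1 + r ^ n))) \<longlongrightarrow> root n (1 - 0)) at_top"
    by (rule tendsto_real_root)
  moreover have "\<forall>\<^sub>F r in at_top. root n (1 - inverse (1 + r ^ n)) = ray_sub n r"
  proof (rule eventually_mono[OF eventually_ge_at_top[of "0::real"]])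
    fix r :: real assume r: "0 \<le> r"
    have "1 - inverse (1 + r ^ n) = ray_sub n r ^ n"
      using ray_sub_power[OF assms r] one_plus_power_pos[OF r, of n] by (simp add: field_simps)
    then show "root n (1 - inverse (1 + r ^ n)) = ray_sub n r"
      using assms ray_sub_range[OF assms r] by (simp add: real_root_power_cancel)
  qed
  ultimately show ?thesis using assms by (simp add: tendsto_cong)
qed

locale complex_F_even = complex_F "2 * m" "m + 1" G for m :: nat and G +
  assumes m: "2 \<le> m"
begin

abbreviation "N \<equiv> 2 * m"
abbreviation "e \<equiv> cis (pi / real N)"
abbreviation "ex \<equiv> real (m + 1) / real N"

text \<open>The parameter drops from \<open>m + 1\<close> to \<open>m\<close>: the exponents
  \<open>m / N\<close> from the integrand and \<open>- 1 / N - 1\<close> from the substitution add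
  up to \<open>- (m + 1) / N\<close>, because \<open>N = 2 * m\<close>.\<close>

lemma F_ray_sub_has_derivative:
  assumes r: "0 < r"
  shows "((\<lambda>r. F N m (ray_sub N r)) has_real_derivative (1 + r ^ N) powr - ex) (at r)"
proof -
  define Q where "Q = 1 + r ^ N"
  have Q: "0 < Q" using r one_plus_power_pos[of r N] by (simp add: Q_def)
  have v: "0 < ray_sub N r" "ray_sub N r < 1"
    using ray_sub_range[of N r] ray_sub_pos[of r N] r m by auto
  have "((\<lambda>r. F N m (ray_sub N r)) has_real_derivative
      (1 - ray_sub N r ^ N) powr - (real m / real N) * Q powr (- (1 / real N) - 1)) (at r)"
    unfolding Q_def
    by (rule DERIV_chain2[OF F_has_derivative ray_sub_has_derivative]) (use v r m in auto)
  also have "1 - ray_sub N r ^ N = inverse Q"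
    using ray_sub_power[of N r] Q r m by (simp add: Q_def field_simps)
  also have "inverse Q powr - (real m / real N) * Q powr (- (1 / real N) - 1) =
      Q powr (real m / real N) * Q powr (- (1 / real N) - 1)"
    using Q by (simp add: powr_minus inverse_powr)
  also have "\<dots> = Q powr (real m / real N + (- (1 / real N) - 1))" by (simp only: powr_add)
  also have "real m / real N + (- (1 / real N) - 1) = - ex"
    using m by (simp add: field_simps)
  finally show ?thesis by (simp only: Q_def)
qed

lemma G_ray_has_derivative:
  assumes r: "0 \<le> r"
  shows "((\<lambda>r. G (of_real r * e)) has_vector_derivative e * of_real ((1 + r ^ N) powr - ex)) (at r)"
proof -
  have "1 - (of_real r * e) ^ N = complex_of_real (1 + r ^ N)"
    using m by (subst power_mult_distrib, subst cis_pi_div_power) auto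
  then have "(G has_field_derivative of_real ((1 + r ^ N) powr - ex)) (at (of_real r * e))"
    using G[OF ray_in_slit_plane[of N r]] r m one_plus_power_pos[OF r, of N]
    by (simp add: of_real_powr_neg del: of_real_add of_real_power of_nat_mult of_nat_add of_real_divide)
  then have "((\<lambda>w. G (w * e)) has_field_derivative of_real ((1 + r ^ N) powr - ex) * e) (at (of_real r))"
    by (rule DERIV_chain2) (auto intro!: derivative_eq_intros)
  then show ?thesis
    using has_vector_derivative_real_field by (simp only: mult.commute)
qed

text \<open>Both sides vanish at 0 and have the same derivative for \<open>r > 0\<close>. The point
  0 is exceptional in the uniqueness theorem and is covered by continuity.\<close>

lemma G_ray:
  assumes r: "0 \<le> r"
  shows "G (of_real r * e) = of_real (F N m (ray_sub N r)) * e"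
proof -
  define D where "D = (\<lambda>r. G (of_real r * e) - of_real (F N m (ray_sub N r)) * e)"
  have "D r = 0"
  proof (rule has_derivative_zero_unique_strong_convex[of "{0..}" "{0}" D 0])
    have "continuous_on {0..} (\<lambda>r. G (of_real r * e))"
      using has_vector_derivative_continuous[OF G_ray_has_derivative]
      by (intro continuous_at_imp_continuous_on ballI) (simp only: atLeast_iff)
    moreover have "continuous_on {0..} (\<lambda>r. F N m (ray_sub N r))"
      by (rule continuous_on_compose2[OF continuous_on_F continuous_on_ray_sub])
         (use m ray_sub_range[of N] in \<open>simp_all add: image_subset_iff less_imp_le\<close>)
    ultimately show "continuous_on {0..} D"
      unfolding D_def by (intro continuous_intros)
    show "D 0 = 0" using G0 by (simp add: D_def)
    fix x :: real assume x: "x \<in> {0..} - {0}"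
    have "((\<lambda>r. of_real (F N m (ray_sub N r)) * e) has_vector_derivative
        of_real ((1 + x ^ N) powr - ex) * e) (at x)"
      by (intro has_vector_derivative_mult_left has_vector_derivative_of_real
            has_real_derivative_iff_has_vector_derivative[THEN iffD1] F_ray_sub_has_derivative)
         (use x in auto)
    from has_vector_derivative_diff[OF G_ray_has_derivative this]
    have "(D has_vector_derivative 0) (at x)" using x by (simp add: D_def mult.commute)
    then show "(D has_derivative (\<lambda>h. 0)) (at x within {0..})"
      by (simp add: has_vector_derivative_def has_derivative_at_withinI)
  qed (use r in auto)
  then show ?thesis by (simp add: D_def)
qed

text \<open>\<open>G\<close> sends the ray into the segment OP without its endpoint P, which lies in
  \<open>Omega\<close>; so the ray qualifies as the connected set \<open>C\<close> of
  \<open>continuation_inverts_G\<close>.\<close>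

lemma S_on_ray:
  assumes S: "analytic_continuation_of_S N (m + 1) S" and r: "0 \<le> r"
  shows "G (of_real r * e) \<in> Omega N (m + 1)" "S (G (of_real r * e)) = of_real r * e"
proof -
  have mem: "G (of_real t * e) \<in> Omega N (m + 1)" if "0 \<le> t" for t
  proof -
    have "F N m (ray_sub N t) \<in> {0..<phi N m}"
      by (rule F_in_range) (use m ray_sub_range[of N t] that in auto)
    then show ?thesis using ray_in_Omega_even[OF m] G_ray[OF that] by simp
  qed
  show "G (of_real r * e) \<in> Omega N (m + 1)" using mem[OF r] .
  show "S (G (of_real r * e)) = of_real r * e"
  proof (rule continuation_inverts_G[OF S, of "(\<lambda>t. of_real t * e) ` {0..}"])
    show "connected ((\<lambda>t. of_real t * e) ` {0..})"
      by (intro connected_continuous_image continuous_intros) simp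
    show "0 \<in> (\<lambda>t. of_real t * e) ` {0..}" by (intro image_eqI[of _ _ 0]) auto
    show "(\<lambda>t. of_real t * e) ` {0..} \<subseteq> slit_plane N"
      using ray_in_slit_plane[of N] m by auto
    show "G ` (\<lambda>t. of_real t * e) ` {0..} \<subseteq> Omega N (m + 1)" using mem by auto
  qed (use r real_in_Omega_even[OF m] in auto)
qed

lemma G_ray_tendsto: "((\<lambda>r. G (of_real r * e)) \<longlongrightarrow> P N (m + 1)) at_top"
proof -
  have "((\<lambda>r. F N m (ray_sub N r)) \<longlongrightarrow> F N m 1) at_top"
  proof (rule continuous_on_tendsto_compose[OF continuous_on_F ray_sub_tendsto])
    show "\<forall>\<^sub>F r in at_top. ray_sub N r \<in> {0..1}"
      by (rule eventually_mono[OF eventually_ge_at_top[of 0]])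
         (use m ray_sub_range[of N] in \<open>auto intro: less_imp_le[OF ray_sub_range(2)]\<close>)
  qed (use m in auto)
  then have "((\<lambda>r. of_real (F N m (ray_sub N r)) * e) \<longlongrightarrow> P N (m + 1)) at_top"
    unfolding P_even'[OF m] phi_def by (intro tendsto_intros)
  moreover have "\<forall>\<^sub>F r in at_top. of_real (F N m (ray_sub N r)) * e = G (of_real r * e)"
    using eventually_ge_at_top[of 0] by (rule eventually_mono) (simp only: G_ray)
  ultimately show ?thesis by (simp add: tendsto_cong)
qed

end

section \<open>Behaviour near the midpoint\<close>


text \<open>On the unit disc \<open>1 + y ^ 2\<close> has positive real part, so the integrand is
  holomorphic there and the disc is convex.\<close>

lemma chart_primitive_exists:
  fixes a :: real and c :: complex
  obtains E where "\<And>y. y \<in> ball 0 1 \<Longrightarrow>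
      (E has_field_derivative c * (1 + y ^ 2) powr - of_real a) (at y)" "E 0 = 0"
proof -
  let ?f = "\<lambda>y::complex. c * (1 + y ^ 2) powr - of_real a"
  have "1 + y ^ 2 \<notin> \<real>\<^sub>\<le>\<^sub>0" if y: "y \<in> ball 0 1" for y :: complex
  proof -
    have "cmod (y ^ 2) < 1" using y by (simp add: norm_power power_less_one_iff)
    then have "\<bar>Re (y ^ 2)\<bar> < 1" by (meson abs_Re_le_cmod le_less_trans)
    then show ?thesis by (simp add: complex_nonpos_Reals_iff)
  qed
  then have "?f holomorphic_on ball 0 1" by (intro holomorphic_intros)
  then obtain E :: "complex \<Rightarrow> complex" where E: "\<And>y. y \<in> ball 0 1 \<Longrightarrow> (E has_field_derivative ?f y) (at y within ball 0 1)"
    using holomorphic_convex_primitive'[of "ball 0 1" ?f] by auto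
  show ?thesis
  proof (rule that[of "\<lambda>y. E y - E 0"])
    fix y :: complex assume y: "y \<in> ball 0 1"
    then have "(E has_field_derivative ?f y) (at y)" using E at_within_open[OF y open_ball] by metis
    then show "((\<lambda>y. E y - E 0) has_field_derivative ?f y) (at y)"
      by (auto intro!: derivative_eq_intros)
  qed simp
qed

context complex_F_even
begin

text \<open>In the coordinate \<open>y = 1 / r ^ m\<close> the point at infinity of the ray becomes
  the regular point 0. Both sides have equal derivatives in \<open>r\<close>, and letting
  \<open>r\<close> tend to infinity fixes the constant as P.\<close>

lemma chart_at_P:
  obtains E where "\<And>y. y \<in> ball 0 1 \<Longrightarrow>
      (E has_field_derivative (1 / of_nat m) * (1 + y ^ 2) powr - of_real ex) (at y)" "E 0 = 0"
    "\<And>r. 1 < r \<Longrightarrow> G (of_real r * e) = P N (m + 1) - e * E (of_real (1 / r ^ m))"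
proof -
  obtain E :: "complex \<Rightarrow> complex" where E: "\<And>y. y \<in> ball 0 1 \<Longrightarrow>
      (E has_field_derivative (1 / of_nat m) * (1 + y ^ 2) powr - of_real ex) (at y)"
    and E0: "E 0 = 0"
    using chart_primitive_exists[of "1 / of_nat m" ex] by blast
  define y :: "real \<Rightarrow> real" where "y = (\<lambda>r. 1 / r ^ m)"
  define D where "D = (\<lambda>r. G (of_real r * e) + e * E (of_real (y r)))"
  have y: "0 < y r" "y r < 1" if "1 < r" for r
    using that m one_less_power[of r m] by (auto simp: y_def)
  have dE: "((\<lambda>r. E (of_real (y r))) has_vector_derivative of_real (- ((1 + r ^ N) powr - ex))) (at r)"
    if r: "1 < r" for r
  proof -
    define Q where "Q = 1 + r ^ N"
    have Q: "0 < Q" using r by (simp add: Q_def add_pos_pos)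
    have dy: "(y has_real_derivative - (real m / r ^ (m + 1))) (at r)"
    proof -
      have "r ^ (m + 1) * r ^ (m - 1) = r ^ m * r ^ m"
      proof -
        have "m + 1 + (m - 1) = m + m" using m by simp
        then show ?thesis by (metis power_add)
      qed
      then have "real m * r ^ (m - 1) / (r ^ m * r ^ m) = real m / r ^ (m + 1)"
        using r by (simp add: field_simps)
      then show ?thesis
        unfolding y_def using r by (auto intro!: derivative_eq_intros simp: power_add)
    qed
    then have 1: "((\<lambda>r. complex_of_real (y r)) has_vector_derivative
        of_real (- (real m / r ^ (m + 1)))) (at r)"
      by (intro has_vector_derivative_of_real) (simp add: has_real_derivative_iff_has_vector_derivative)
    have "(E has_field_derivative (1 / of_nat m) * (1 + of_real (y r) ^ 2) powr - of_real ex)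
        (at (of_real (y r)))"
      by (rule E) (use y[OF r] in simp)
    from field_vector_diff_chain_at[OF 1 this]
    have "((\<lambda>r. E (of_real (y r))) has_vector_derivative
        of_real (- (real m / r ^ (m + 1))) * ((1 / of_nat m) * (1 + of_real (y r) ^ 2) powr - of_real ex)) (at r)"
      by (simp only: o_def)
    also have "(1 + complex_of_real (y r) ^ 2) powr - of_real ex = of_real ((1 + y r ^ 2) powr - ex)"
    proof -
      have "0 < 1 + y r ^ 2" by (simp add: add_pos_nonneg)
      from of_real_powr_neg[OF this, of ex] show ?thesis
        by (simp only: of_real_add of_real_1 of_real_power)
    qed
    also have "1 + y r ^ 2 = Q / r ^ N"
      using r by (simp add: y_def Q_def field_simps power_mult power_even_eq)
    \<comment> \<open>Since \<open>N * ex = m + 1\<close>, the power of \<open>r\<close> produced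
      here cancels the one in the derivative of \<open>y\<close>.\<close>
    also have "(Q / r ^ N) powr - ex = Q powr - ex * r ^ (m + 1)"
    proof -
      have "(r ^ N) powr ex = r powr (real N * ex)"
        using r by (simp add: powr_powr flip: powr_realpow)
      also have "real N * ex = real (m + 1)" using m by simp
      also have "r powr real (m + 1) = r ^ (m + 1)" using r by (subst powr_realpow) auto
      finally have *: "(r ^ N) powr ex = r ^ (m + 1)" .
      have "(Q / r ^ N) powr - ex = Q powr - ex / (r ^ N) powr - ex"
        using Q r by (subst powr_divide) auto
      also have "\<dots> = Q powr - ex * (r ^ N) powr ex"
        by (simp only: powr_minus divide_inverse inverse_inverse_eq)
      finally show ?thesis by (simp only: *)
    qed
    also have "complex_of_real (- (real m / r ^ (m + 1))) *
        ((1 / of_nat m) * of_real (Q powr - ex * r ^ (m + 1))) = of_real (- (Q powr - ex))"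
      using r m by (simp add: field_simps)
    finally show ?thesis by (simp only: Q_def)
  qed
  \<comment> \<open>The base point 2 is arbitrary; \<open>r > 1\<close> keeps \<open>y r\<close> in
    the unit disc.\<close>
  have const: "D r = D 2" if r: "1 < r" for r
  proof (rule has_derivative_zero_unique_strong_convex[of "{1<..}" "{}" D 2])
    have der: "(D has_derivative (\<lambda>h. 0)) (at x)" if x: "1 < x" for x
    proof -
      have "((\<lambda>r. e * E (of_real (y r))) has_vector_derivative
          e * of_real (- ((1 + x ^ N) powr - ex))) (at x)"
        by (intro has_vector_derivative_mult_right dE x)
      from has_vector_derivative_add[OF G_ray_has_derivative this]
      have "(D has_vector_derivative 0) (at x)" using x by (simp add: D_def)
      then show ?thesis by (simp add: has_vector_derivative_def)
    qed
    then show "(D has_derivative (\<lambda>h. 0)) (at x within {1<..})" if "x \<in> {1<..} - {}" for x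
      using that by (simp add: has_derivative_at_withinI)
    show "continuous_on {1<..} D"
      using der by (intro continuous_at_imp_continuous_on ballI) (auto dest: has_derivative_continuous)
  qed (use r in auto)
  have "(D \<longlongrightarrow> P N (m + 1) + e * E 0) at_top"
  proof -
    have "filterlim (\<lambda>r::real. r ^ m) at_top at_top"
      by (intro filterlim_pow_at_top filterlim_ident) (use m in simp)
    from filterlim_compose[OF tendsto_inverse_0_at_top[OF filterlim_ident] this]
    have "(y \<longlongrightarrow> 0) at_top" by (simp add: y_def inverse_eq_divide)
    then have y0: "((\<lambda>r. complex_of_real (y r)) \<longlongrightarrow> 0) at_top"
      using tendsto_of_real[of y 0] by simp
    have "isCont E 0" using E[of 0] by (auto intro: DERIV_isCont)
    then have "((\<lambda>r. E (of_real (y r))) \<longlongrightarrow> E 0) at_top"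
      using y0 by (rule isCont_tendsto_compose)
    then show ?thesis unfolding D_def by (intro tendsto_intros G_ray_tendsto)
  qed
  moreover have "(D \<longlongrightarrow> D 2) at_top"
    by (rule tendsto_eventually[OF eventually_mono[OF eventually_gt_at_top const]])
  ultimately have "D 2 = P N (m + 1)"
    using tendsto_unique[OF trivial_limit_at_top_linorder] E0 by fastforce
  then have "G (of_real r * e) = P N (m + 1) - e * E (of_real (1 / r ^ m))" if "1 < r" for r
    using const[OF that] by (simp add: D_def y_def algebra_simps)
  then show thesis using that[of E] E E0 by blast
qed

text \<open>\<open>Y\<close> is the local inverse of \<open>Z y = P - e * E y\<close>. On the ray
  \<open>S = r * e\<close> and \<open>Y = 1 / r ^ m\<close>, so the product is \<open>e ^ m\<close>,
  that is \<open>\<i>\<close>; the identity theorem spreads this over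
  \<open>U \<inter> Omega\<close>.\<close>

lemma local_form_at_P:
  assumes S: "analytic_continuation_of_S N (m + 1) S"
  obtains U Y where "open U" "P N (m + 1) \<in> U" "Y holomorphic_on U"
    "Y (P N (m + 1)) = 0" "deriv Y (P N (m + 1)) \<noteq> 0"
    "\<And>z. z \<in> U \<inter> Omega N (m + 1) \<Longrightarrow> S z ^ m * Y z = \<i>"
proof -
  let ?P = "P N (m + 1)" and ?\<Omega> = "Omega N (m + 1)"
  obtain E where E: "\<And>y. y \<in> ball 0 1 \<Longrightarrow>
      (E has_field_derivative (1 / of_nat m) * (1 + y ^ 2) powr - of_real ex) (at y)"
    and E0: "E 0 = 0"
    and ray: "\<And>r. 1 < r \<Longrightarrow> G (of_real r * e) = ?P - e * E (of_real (1 / r ^ m))"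
    using chart_at_P by blast
  define Z where "Z = (\<lambda>y. ?P - e * E y)"
  have Z0: "Z 0 = ?P" by (simp add: Z_def E0)
  have dZ: "(Z has_field_derivative - (e * ((1 / of_nat m) * (1 + y ^ 2) powr - of_real ex))) (at y)"
    if "y \<in> ball 0 1" for y
    unfolding Z_def using E[OF that] by (auto intro!: derivative_eq_intros)
  have holZ: "Z holomorphic_on ball 0 1"
    unfolding holomorphic_on_open[OF open_ball] using dZ by blast
  have "deriv Z 0 = - (e * ((1 / of_nat m) * (1 + 0 ^ 2) powr - of_real ex))"
    using dZ[of 0] by (intro DERIV_imp_deriv) simp
  then have dZ0: "deriv Z 0 \<noteq> 0" using m by simp
  obtain \<rho> where \<rho>: "0 < \<rho>" "ball 0 \<rho> \<subseteq> ball (0::complex) 1" "inj_on Z (ball 0 \<rho>)"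
    using has_complex_derivative_locally_injective[OF holZ _ open_ball dZ0] by auto
  have holZ': "Z holomorphic_on ball 0 \<rho>" using holZ \<rho>(2) holomorphic_on_subset by blast
  obtain Y where holY: "Y holomorphic_on Z ` ball 0 \<rho>"
    and dY: "\<And>y. y \<in> ball 0 \<rho> \<Longrightarrow> deriv Z y * deriv Y (Z y) = 1"
    and YZ: "\<And>y. y \<in> ball 0 \<rho> \<Longrightarrow> Y (Z y) = y"
    using holomorphic_has_inverse[OF holZ' open_ball \<rho>(3)] by blast
  have "open (Z ` ball 0 \<rho>)" by (rule open_mapping_thm3[OF holZ' open_ball \<rho>(3)])
  moreover have "?P \<in> Z ` ball 0 \<rho>" using \<rho>(1) Z0 by (intro image_eqI[of _ _ 0]) auto
  ultimately obtain \<epsilon> where \<epsilon>: "0 < \<epsilon>" "ball ?P \<epsilon> \<subseteq> Z ` ball 0 \<rho>" by (meson openE)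
  \<comment> \<open>A disc rather than the whole image of \<open>Z\<close>, so that its intersection
    with the convex \<open>Omega\<close> is connected.\<close>
  define U where "U = ball ?P \<epsilon>"
  define V where "V = U \<inter> ?\<Omega>"
  have V: "open V" "connected V"
    unfolding V_def U_def using convex_Omega_even[OF m]
    by (auto intro!: convex_connected convex_Int open_Omega open_Int)
  have holYU: "Y holomorphic_on U" using holY \<epsilon>(2) unfolding U_def by (rule holomorphic_on_subset)
  have holSV: "S holomorphic_on V"
    using S unfolding analytic_continuation_of_S_def V_def by (auto elim: holomorphic_on_subset)
  have hol: "(\<lambda>z. S z ^ m * Y z - \<i>) holomorphic_on V"
    by (intro holomorphic_intros holSV holomorphic_on_subset[OF holYU]) (auto simp: V_def)
  have em: "e ^ m = \<i>"
  proof -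
    have "real m * (pi / real N) = pi / 2" using m by (simp add: field_simps)
    then show ?thesis by (simp only: Complex.DeMoivre cis_pi_half)
  qed
  define z where "z = (\<lambda>r. G (of_real r * e))"
  have "\<forall>\<^sub>F r in at_top. z r \<in> U"
    unfolding U_def z_def by (rule topological_tendstoD[OF G_ray_tendsto]) (use \<epsilon> in auto)
  \<comment> \<open>Having \<open>z r\<close> in \<open>U\<close> does not tell which preimage under
    \<open>Z\<close> lies in the small disc; this bound puts \<open>1 / r ^ m\<close> where
    \<open>Y\<close> inverts \<open>Z\<close>.\<close>
  moreover have "\<forall>\<^sub>F r in at_top. 1 / r ^ m < \<rho>"
  proof -
    have "filterlim (\<lambda>r::real. r ^ m) at_top at_top"
      by (intro filterlim_pow_at_top filterlim_ident) (use m in simp)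
    from filterlim_compose[OF tendsto_inverse_0_at_top[OF filterlim_ident] this]
    have "((\<lambda>r::real. 1 / r ^ m) \<longlongrightarrow> 0) at_top" by (simp add: inverse_eq_divide)
    then show ?thesis using \<rho>(1) by (rule order_tendstoD)
  qed
  ultimately have "\<forall>\<^sub>F r in at_top. z r \<in> U \<and> 1 / r ^ m < \<rho> \<and> 1 < r"
    using eventually_gt_at_top[of 1] by eventually_elim simp
  then obtain r0 where r0: "\<And>r. r0 \<le> r \<Longrightarrow> z r \<in> U \<and> 1 / r ^ m < \<rho> \<and> 1 < r"
    unfolding eventually_at_top_linorder by blast
  define I where "I = z ` {r0..}"
  have IV: "I \<subseteq> V"
    using r0 S_on_ray(1)[OF S] unfolding I_def V_def z_def
    by (auto simp del: of_nat_mult) (smt (verit))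
  have Sz: "S (z r) = of_real r * e" if "r0 \<le> r" for r
    unfolding z_def by (rule S_on_ray(2)[OF S]) (use r0[OF that] in auto)
  have zero: "S w ^ m * Y w - \<i> = 0" if w: "w \<in> I" for w
  proof -
    obtain r where r: "r0 \<le> r" "w = z r" using w by (auto simp: I_def)
    have "w = Z (of_real (1 / r ^ m))"
      using ray r0[OF r(1)] by (simp only: r z_def Z_def)
    moreover have "complex_of_real (1 / r ^ m) \<in> ball 0 \<rho>"
      using r0[OF r(1)] by (simp add: norm_divide norm_power)
    ultimately have "Y w = of_real (1 / r ^ m)" using YZ by simp
    moreover have "r \<noteq> 0" using r0[OF r(1)] by auto
    ultimately show ?thesis using Sz[OF r(1)] by (simp add: r(2) power_mult_distrib em del: of_nat_mult)
  qed
  have conI: "connected I"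
    unfolding I_def
  proof (rule connected_continuous_image)
    show "continuous_on {r0..} z"
      unfolding z_def
    proof (intro continuous_at_imp_continuous_on ballI)
      fix r assume "r \<in> {r0..}"
      then have "0 \<le> r" using r0[of r] by auto
      then show "isCont (\<lambda>r. G (of_real r * e)) r"
        by (rule has_vector_derivative_continuous[OF G_ray_has_derivative])
    qed
  qed simp
  have zI: "z r0 \<in> I" "z (r0 + 1) \<in> I" by (auto simp: I_def)
  \<comment> \<open>\<open>S\<close> takes the different values \<open>r0 * e\<close> and
    \<open>(r0 + 1) * e\<close> there. Hence the connected set \<open>I\<close> is not a single
    point and each of its points is a limit point.\<close>
  have "z r0 \<noteq> z (r0 + 1)"
    using Sz[of r0] Sz[of "r0 + 1"] by auto
  then have "I \<noteq> {x}" for x using zI by auto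
  then have lim: "z r0 islimpt I" using connected_imp_perfect[OF conI zI(1)] by blast
  have "S w ^ m * Y w - \<i> = 0" if "w \<in> V" for w
    by (rule analytic_continuation[OF hol V IV _ lim zero that]) (use zI IV in auto)
  moreover have "Y ?P = 0" "deriv Y ?P \<noteq> 0" using YZ[of 0] dY[of 0] \<rho>(1) Z0 by auto
  ultimately show thesis
    using that[of U Y] holYU \<epsilon>(1) by (auto simp: U_def V_def)
qed

end

section \<open>Excluding a continuation of \<open>S\<close> itself\<close>

text \<open>P is approached along the segment OP. This turns agreement on \<open>Omega\<close> into
  an identity at points arbitrarily close to P.\<close>

lemma P_islimpt_Omega:
  assumes m: "2 \<le> m"
  shows "P (2 * m) (m + 1) islimpt Omega (2 * m) (m + 1)"
  unfolding islimpt_approachable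
proof (intro allI impI)
  fix \<epsilon> :: real assume \<epsilon>: "0 < \<epsilon>"
  define R where "R = phi (2 * m) m"
  \<comment> \<open>The maximum keeps the point on the ray when \<open>\<epsilon>\<close> is large;
    the half makes the distance strictly less than \<open>\<epsilon>\<close>.\<close>
  define t where "t = max 0 (R - \<epsilon> / 2)"
  have R: "0 < R" using phi_pos[of "2 * m" m] m by (simp add: R_def)
  have t: "0 \<le> t" "t < R" "R - t < \<epsilon>" using \<epsilon> R by (auto simp: t_def)
  let ?w = "of_real t * cis (pi / real (2 * m))"
  have d: "dist ?w (P (2 * m) (m + 1)) = R - t"
  proof -
    have "?w - P (2 * m) (m + 1) = of_real (t - R) * cis (pi / real (2 * m))"
      unfolding P_even'[OF m] R_def by (simp add: algebra_simps)
    then have "dist ?w (P (2 * m) (m + 1)) = cmod (of_real (t - R) * cis (pi / real (2 * m)))"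
      by (simp only: dist_norm)
    then show ?thesis using t by (simp add: norm_mult del: of_real_diff)
  qed
  then have "?w \<noteq> P (2 * m) (m + 1)" using t by (metis dist_eq_0_iff diff_gt_0_iff_gt less_irrefl)
  then show "\<exists>x'\<in>Omega (2 * m) (m + 1). x' \<noteq> P (2 * m) (m + 1) \<and> dist x' (P (2 * m) (m + 1)) < \<epsilon>"
    using ray_in_Omega_even[OF m, of t] t d R_def by (intro bexI[of _ ?w]) auto
qed

text \<open>Comparing orders at \<open>p\<close> gives \<open>m * zorder g p + 1 = 0\<close>, so
  \<open>m\<close> would divide 1. The relation is assumed only frequently near \<open>p\<close>, as
  it is known only on \<open>Omega\<close>, which has P on its boundary.\<close>

lemma no_meromorphic_root_of_simple_pole:
  assumes g: "g meromorphic_on {p}"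
    and Y: "Y holomorphic_on U" "open U" "p \<in> U" "Y p = 0" "deriv Y p \<noteq> 0"
    and m: "2 \<le> m" and c: "c \<noteq> 0"
    and freq: "\<exists>\<^sub>F z in at p. g z ^ m * Y z = c"
  shows False
proof -
  have merY: "Y meromorphic_on {p}"
    using Y by (meson analytic_on_holomorphic analytic_on_imp_meromorphic_on empty_subsetI
        insert_subset)
  have "(\<lambda>z. g z ^ m * Y z - c) meromorphic_on {p}"
    by (intro meromorphic_intros g merY)
  \<comment> \<open>A function meromorphic at \<open>p\<close> with zeros accumulating at
    \<open>p\<close> vanishes on a punctured neighborhood.\<close>
  then have "\<forall>\<^sub>F z in at p. g z ^ m * Y z - c = 0"
    using freq
    by (intro not_essential_frequently_0_imp_eventually_0)
       (auto simp: meromorphic_at_iff)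
  then have ev: "\<forall>\<^sub>F z in at p. g z ^ m * Y z = c" by simp
  \<comment> \<open>The product is the nonzero \<open>c\<close>; nonvanishing of the factors is what
    additivity of orders needs.\<close>
  then have "\<forall>\<^sub>F z in at p. g z \<noteq> 0 \<and> Y z \<noteq> 0"
    by eventually_elim (use c m in \<open>auto simp: power_0_left\<close>)
  then have nz: "\<exists>\<^sub>F z in at p. g z \<noteq> 0" "\<exists>\<^sub>F z in at p. Y z \<noteq> 0" "\<exists>\<^sub>F z in at p. g z ^ m \<noteq> 0"
    by (auto intro!: eventually_frequently elim: eventually_mono)
  have "zorder (\<lambda>z. g z ^ m * Y z) p = int m * zorder g p + zorder Y p"
    using zorder_mult[OF meromorphic_on_power[OF g] nz(3) merY nz(2)] zorder_power[OF g nz(1)] by simp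
  moreover have "zorder Y p = 1"
    by (rule zorder_zero_eqI[OF Y(1-3)]) (use Y in auto)
  moreover have "zorder (\<lambda>z. g z ^ m * Y z) p = zorder (\<lambda>_. c) p"
    using ev by (rule zorder_cong) simp
  moreover have "zorder (\<lambda>_. c) p = 0"
    by (rule zorder_eq_0I) (use c in auto)
  ultimately have "int m * - zorder g p = 1" by simp
  then have "int m dvd 1" by (metis dvd_triv_left)
  then show False using m by simp
qed

theorem proposition7:
  fixes n k :: nat and S :: "complex \<Rightarrow> complex"
  assumes "n > 2" and "even n" and "k = n div 2 + 1"
    and "analytic_continuation_of_S n k S"
  shows "continues_meromorphically_to (\<lambda>z. S z ^ (n div 2)) (Omega n k) (P n k) \<and>
         \<not> continues_meromorphically_to S (Omega n k) (P n k)"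
proof -
  obtain m where nm: "n = 2 * m" using assms(2) by (elim evenE)
  have km: "k = m + 1" and m: "2 \<le> m" using assms(1,3) nm by auto
  have S: "analytic_continuation_of_S (2 * m) (m + 1) S" using assms(4) nm km by simp
  obtain G where G: "\<And>w. w \<in> slit_plane (2 * m) \<Longrightarrow>
      (G has_field_derivative (1 - w ^ (2 * m)) powr - of_real (real (m + 1) / real (2 * m))) (at w)"
    "G 0 = 0"
    using complex_F_exists[of "2 * m" "m + 1"] m by auto
  interpret complex_F_even m G
    by unfold_locales (use m G in auto)
  obtain U Y where U: "open U" "P n k \<in> U" and Y: "Y holomorphic_on U"
    "Y (P n k) = 0" "deriv Y (P n k) \<noteq> 0"
    and eq: "\<And>z. z \<in> U \<inter> Omega n k \<Longrightarrow> S z ^ m * Y z = \<i>"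
    using local_form_at_P[OF S] unfolding nm km by blast
  have "continues_meromorphically_to (\<lambda>z. S z ^ (n div 2)) (Omega n k) (P n k)"
    unfolding continues_meromorphically_to_def
  proof (intro exI conjI ballI)
    show "(\<lambda>z. \<i> / Y z) meromorphic_on U"
      using Y(1) U(1)
      by (intro meromorphic_intros analytic_on_imp_meromorphic_on) (simp add: analytic_on_open)
    fix z assume "z \<in> U \<inter> Omega n k"
    \<comment> \<open>The case \<open>Y z = 0\<close> contradicts \<open>eq\<close>, whose right
      side is \<open>\<i>\<close>.\<close>
    from eq[OF this] show "\<i> / Y z = S z ^ (n div 2)"
      by (cases "Y z = 0") (simp_all add: nm field_simps)
  qed (use U in auto)
  moreover have "\<not> continues_meromorphically_to S (Omega n k) (P n k)"
  proof
    assume "continues_meromorphically_to S (Omega n k) (P n k)"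
    then obtain W g where W: "open W" "P n k \<in> W" and g: "g meromorphic_on W"
      and gS: "\<And>z. z \<in> W \<inter> Omega n k \<Longrightarrow> g z = S z"
      unfolding continues_meromorphically_to_def by auto
    have "\<exists>\<^sub>F z in at (P n k). z \<in> Omega n k"
      using P_islimpt_Omega[OF m] by (simp add: islimpt_conv_frequently_at nm km)
    moreover have "\<forall>\<^sub>F z in at (P n k). z \<in> U \<inter> W"
      by (rule eventually_at_in_open') (use U W in auto)
    ultimately have "\<exists>\<^sub>F z in at (P n k). z \<in> U \<inter> W \<and> z \<in> Omega n k"
      by (rule frequently_eventually_conj)
    then have freq: "\<exists>\<^sub>F z in at (P n k). g z ^ m * Y z = \<i>"
      by (rule frequently_elim1) (use eq gS in auto)
    show False
      by (rule no_meromorphic_root_of_simple_pole[OF _ Y(1) U Y(2,3) m _ freq])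
         (use g W in \<open>auto elim: meromorphic_on_subset\<close>)
  qed
  ultimately show ?thesis ..
qed

end
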